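(* Let $G$ be a finite group, let $F$ be a field which is an algebraic extension of $\mathbb{Q}$, let $FG$ be the group algebra, and let $\sigma$ be an involution of $FG$ which fixes $F$ pointwise. Then there exist an involution $\theta$ on $F$, a (finite dimensional) right $F$-vector space $M$ which is also a left $FG$-module, and a nonsingular hermitian or skew-hermitian form $h:M\times M\rightarrow F$ on $M$ (with respect to the involution $\theta$ on $F$) such that $\sigma$ is the adjoint involution of $h$ and $$FG_\sigma^-=\left\{f\in FG\;|\;h(f(x),y)+h(x,f(y))=0\;\text{for all}\;x,y\in M\right\}.$$
   Context: An involution of a ring $R$ is an additive map $\sigma:R\to R$ with $\sigma(xy)=\sigma(y)\sigma(x)$ and $\sigma^2=\mathrm{id}$; in particular an involution on the field $F$ is a field automorphism $\theta$ with $\theta^2=\mathrm{id}$ (the identity is allowed). $FG_\sigma^-=\{\gamma\in FG\;|\;\sigma(\gamma)=-\gamma\}$ is the set of skew-symmetric elements of $FG$ with respect to $\sigma$. The left $FG$-module structure and the right $F$-vector space structure on $M$ are compatible: $F\subseteq FG$ acts through the scalar multiplication of $M$, so each $f\in FG$ acts on $M$ as an $F$-linear map $x\mapsto f(x)$. A hermitian form on $M$ with respect to $\theta$ is a bi-additive map $h:M\times M\to F$ such that $h(x\alpha,y\beta)=\theta(\alpha)h(x,y)\beta$ and $h(y,x)=\theta(h(x,y))$ for all $x,y\in M$, $\alpha,\beta\in F$; it is called skew-hermitian if the second condition is replaced by $h(y,x)=-\theta(h(x,y))$. (When $\theta=\mathrm{id}$ these are the symmetric, resp. skew-symmetric, bilinear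 forms.) The form $h$ is nonsingular if the only $x\in M$ with $h(x,y)=0$ for all $y\in M$ is $x=0$. "$\sigma$ is the adjoint involution of $h$" means $h(x,f(y))=h(\sigma(f)(x),y)$ for all $x,y\in M$ and all $f\in FG$. *)

theory Defs
  imports
    "HOL-Library.Poly_Mapping"
    "HOL-Computational_Algebra.Polynomial"
    "HOL-Algebra.Algebraic_Closure_Type"
begin

text \<open>
  Finite groups are types of sort \<open>{group_add, finite}\<close>: the class \<open>group_add\<close> is
  the library's class of arbitrary (not necessarily commutative) groups, written additively.
  With this convention the convolution ring of \<open>HOL-Library.Poly_Mapping\<close> on
  \<open>'g \<Rightarrow>\<^sub>0 'f\<close> is the group algebra: \<open>single g 1 * single h 1 = single (g + h) 1\<close>, and
  \<open>single 0 1\<close> is its unit.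
\<close>

type_synonym ('g, 'f) group_algebra = "'g \<Rightarrow>\<^sub>0 'f"

abbreviation scalar :: "'f \<Rightarrow> ('g::{group_add, finite}, 'f::field) group_algebra" where
  "scalar \<alpha> \<equiv> Poly_Mapping.single 0 \<alpha>"

definition ring_involution :: "('a::ring \<Rightarrow> 'a) \<Rightarrow> bool" where
  "ring_involution \<sigma> \<longleftrightarrow>
     (\<forall>x y. \<sigma> (x + y) = \<sigma> x + \<sigma> y) \<and>
     (\<forall>x y. \<sigma> (x * y) = \<sigma> y * \<sigma> x) \<and>
     (\<forall>x. \<sigma> (\<sigma> x) = x)"

definition skew_elements :: "('a::ring \<Rightarrow> 'a) \<Rightarrow> 'a set" where
  "skew_elements \<sigma> = {\<gamma>. \<sigma> \<gamma> = - \<gamma>}"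

text \<open>
  The library's \<open>module\<close> locale over the field \<open>ring_of_type_algebra\<close> (the type \<open>'f\<close> viewed
  as a ring record) gives the vector spaces over \<open>'f\<close>. As \<open>'f\<close> is commutative, a right
  vector space is the same thing, and \<open>\<alpha> \<odot>\<^bsub>M\<^esub> x\<close> stands for the right
  multiple \<open>x\<alpha>\<close>. The multiplication and unit fields of the record are not used.
  When a vector space is to be constructed, \<open>'m\<close> may be taken to be \<open>nat \<Rightarrow> 'f\<close>: this type
  contains a copy of every finite-dimensional space as a carrier.
\<close>

definition fin_dim_vector_space :: "('f::field, 'm) module \<Rightarrow> bool" where
  "fin_dim_vector_space M \<longleftrightarrow>
     module (ring_of_type_algebra :: 'f ring) M \<and>
     (\<exists>B. finite B \<and> B \<subseteq> carrier M \<and>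
        (\<forall>x\<in>carrier M. \<exists>c. x = (\<Oplus>\<^bsub>M\<^esub>b\<in>B. c b \<odot>\<^bsub>M\<^esub> b)))"

text \<open>The library's \<open>module\<close> locale requires commutative scalars.\<close>

locale left_module = abelian_group M for M :: "('m, 'b) ring_scheme" (structure) +
  fixes act :: "'r::ring_1 \<Rightarrow> 'm \<Rightarrow> 'm"
  assumes act_closed: "x \<in> carrier M \<Longrightarrow> act r x \<in> carrier M"
    and act_add_left: "x \<in> carrier M \<Longrightarrow> act (r + s) x = act r x \<oplus> act s x"
    and act_add_right:
      "x \<in> carrier M \<Longrightarrow> y \<in> carrier M \<Longrightarrow> act r (x \<oplus> y) = act r x \<oplus> act r y"
    and act_mult: "x \<in> carrier M \<Longrightarrow> act (r * s) x = act r (act s x)"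
    and act_one: "x \<in> carrier M \<Longrightarrow> act 1 x = x"

definition compatible_action ::
  "('f::field, 'm) module \<Rightarrow> (('g::{group_add, finite}, 'f) group_algebra \<Rightarrow> 'm \<Rightarrow> 'm) \<Rightarrow> bool"
  where
  "compatible_action M act \<longleftrightarrow> (\<forall>\<alpha>. \<forall>x\<in>carrier M. act (scalar \<alpha>) x = \<alpha> \<odot>\<^bsub>M\<^esub> x)"

definition sesquilinear_form ::
  "('f::field, 'm) module \<Rightarrow> ('f \<Rightarrow> 'f) \<Rightarrow> ('m \<Rightarrow> 'm \<Rightarrow> 'f) \<Rightarrow> bool" where
  "sesquilinear_form M \<theta> h \<longleftrightarrow>
     (\<forall>x\<in>carrier M. \<forall>x'\<in>carrier M. \<forall>y\<in>carrier M. h (x \<oplus>\<^bsub>M\<^esub> x') y = h x y + h x' y) \<and>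
     (\<forall>x\<in>carrier M. \<forall>y\<in>carrier M. \<forall>y'\<in>carrier M. h x (y \<oplus>\<^bsub>M\<^esub> y') = h x y + h x y') \<and>
     (\<forall>x\<in>carrier M. \<forall>y\<in>carrier M. \<forall>\<alpha> \<beta>.
        h (\<alpha> \<odot>\<^bsub>M\<^esub> x) (\<beta> \<odot>\<^bsub>M\<^esub> y) = \<theta> \<alpha> * h x y * \<beta>)"

definition hermitian_form ::
  "('f::field, 'm) module \<Rightarrow> ('f \<Rightarrow> 'f) \<Rightarrow> ('m \<Rightarrow> 'm \<Rightarrow> 'f) \<Rightarrow> bool" where
  "hermitian_form M \<theta> h \<longleftrightarrow>
     sesquilinear_form M \<theta> h \<and> (\<forall>x\<in>carrier M. \<forall>y\<in>carrier M. h y x = \<theta> (h x y))"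

definition skew_hermitian_form ::
  "('f::field, 'm) module \<Rightarrow> ('f \<Rightarrow> 'f) \<Rightarrow> ('m \<Rightarrow> 'm \<Rightarrow> 'f) \<Rightarrow> bool" where
  "skew_hermitian_form M \<theta> h \<longleftrightarrow>
     sesquilinear_form M \<theta> h \<and> (\<forall>x\<in>carrier M. \<forall>y\<in>carrier M. h y x = - \<theta> (h x y))"

definition nonsingular_form ::
  "('f::field, 'm) module \<Rightarrow> ('m \<Rightarrow> 'm \<Rightarrow> 'f) \<Rightarrow> bool" where
  "nonsingular_form M h \<longleftrightarrow>
     (\<forall>x\<in>carrier M. (\<forall>y\<in>carrier M. h x y = 0) \<longrightarrow> x = \<zero>\<^bsub>M\<^esub>)"

definition adjoint_involution ::
  "('f::field, 'm) module \<Rightarrow> ('r \<Rightarrow> 'm \<Rightarrow> 'm) \<Rightarrow> ('m \<Rightarrow> 'm \<Rightarrow> 'f) \<Rightarrow> ('r \<Rightarrow> 'r) \<Rightarrow> bool" where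
  "adjoint_involution M act h \<sigma> \<longleftrightarrow>
     (\<forall>f. \<forall>x\<in>carrier M. \<forall>y\<in>carrier M. h x (act f y) = h (act (\<sigma> f) x) y)"

end

theory Submission
  imports Defs
begin

text \<open>
  The regular module \<open>M = FG\<close> works with \<open>\<theta> = id\<close>. Let \<open>t(x)\<close> be the coefficient
  of \<open>x\<close> at the identity of \<open>G\<close> and put \<open>h(x, y) = t(\<sigma>(x) y)\<close>. The adjoint identity is
  \<open>\<sigma>(x) f y = \<sigma>(\<sigma>(f) x) y\<close>, and \<open>h\<close> is nonsingular because multiplying by \<open>g\<^sup>-\<^sup>1\<close> moves
  the coefficient at \<open>g\<close> to the identity. What has to be proved is symmetry. As
  \<open>\<sigma>(\<sigma>(x) y) = \<sigma>(y) x\<close>, it amounts to \<open>t(\<sigma>(x)) = t(x)\<close> (\<open>lookup_zero_involution\<close>).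

  That equation holds even when \<open>\<sigma>\<close> does not preserve the basis \<open>G\<close>, because \<open>t\<close> has a
  description independent of the basis: \<open>|G| t(x)\<close> is the trace of left multiplication by \<open>x\<close>,
  and also the trace of right multiplication by \<open>x\<close>. Being an anti-automorphism, \<open>\<sigma>\<close> conjugates
  left multiplication by \<open>\<sigma>(x)\<close> to right multiplication by \<open>x\<close>, and conjugate maps
  have the same trace. In characteristic \<open>0\<close> the factor \<open>|G|\<close> can be cancelled.

  The elements \<open>f\<close> that are skew for \<open>h\<close> are those for which \<open>\<sigma>(f) + f\<close> acts as zero on \<open>M\<close>.
  The regular module is faithful, so this says that \<open>f\<close> is skew-symmetric.
  The elements of \<open>FG\<close> are moved into \<open>nat \<Rightarrow> 'f\<close> by transport of structure along an injection
  (\<open>transported_regular_module\<close>).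
\<close>

section \<open>Coefficients in the group algebra\<close>

abbreviation lookup :: "('g, 'f::zero) group_algebra \<Rightarrow> 'g \<Rightarrow> 'f" where
  "lookup \<equiv> Poly_Mapping.lookup"

lemma sum_single_lookup:
  fixes x :: "('g::finite, 'f::comm_monoid_add) group_algebra"
  shows "(\<Sum>g\<in>UNIV. Poly_Mapping.single g (lookup x g)) = x"
  by (rule poly_mapping_eqI) (simp add: lookup_sum lookup_single when_def)

lemma lookup_mult_single:
  fixes x :: "('g::{group_add, finite}, 'f::field) group_algebra"
  shows "lookup (x * Poly_Mapping.single k \<alpha>) g = lookup x (g - k) * \<alpha>"
proof -
  have eq: "l + k = g \<longleftrightarrow> l = g - k" for l
    by (auto simp: eq_diff_eq)
  have "lookup (x * Poly_Mapping.single k \<alpha>) g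
      = lookup ((\<Sum>l\<in>UNIV. Poly_Mapping.single l (lookup x l)) * Poly_Mapping.single k \<alpha>) g"
    by (simp only: sum_single_lookup)
  also have "\<dots> = lookup x (g - k) * \<alpha>"
    by (simp add: sum_distrib_right mult_single lookup_sum lookup_single when_def eq)
  finally show ?thesis .
qed

lemma lookup_single_mult:
  fixes x :: "('g::{group_add, finite}, 'f::field) group_algebra"
  shows "lookup (Poly_Mapping.single k \<alpha> * x) g = \<alpha> * lookup x (- k + g)"
proof -
  have eq: "k + l = g \<longleftrightarrow> l = - k + g" for l
    by (metis add.assoc add.left_neutral left_minus right_minus)
  have "lookup (Poly_Mapping.single k \<alpha> * x) g
      = lookup (Poly_Mapping.single k \<alpha> * (\<Sum>l\<in>UNIV. Poly_Mapping.single l (lookup x l))) g"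
    by (simp only: sum_single_lookup)
  also have "\<dots> = \<alpha> * lookup x (- k + g)"
    by (simp add: sum_distrib_left mult_single lookup_sum lookup_single when_def eq)
  finally show ?thesis .
qed

lemma scalar_commute:
  fixes x :: "('g::{group_add, finite}, 'f::field) group_algebra"
  shows "x * scalar \<alpha> = scalar \<alpha> * x"
  by (rule poly_mapping_eqI) (simp add: lookup_mult_single lookup_single_mult)

section \<open>The trace of a linear map of the group algebra\<close>

definition linear_on_algebra ::
  "(('g::{group_add, finite}, 'f::field) group_algebra \<Rightarrow> ('g, 'f) group_algebra) \<Rightarrow> bool" where
  "linear_on_algebra A \<longleftrightarrow>
     (\<forall>x y. A (x + y) = A x + A y) \<and> (\<forall>\<alpha> x. A (scalar \<alpha> * x) = scalar \<alpha> * A x)"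

definition trace ::
  "(('g::{group_add, finite}, 'f::field) group_algebra \<Rightarrow> ('g, 'f) group_algebra) \<Rightarrow> 'f" where
  "trace A = (\<Sum>g\<in>UNIV. lookup (A (Poly_Mapping.single g 1)) g)"

lemma lookup_linear_image:
  assumes "linear_on_algebra A"
  shows "lookup (A x) g = (\<Sum>k\<in>UNIV. lookup x k * lookup (A (Poly_Mapping.single k 1)) g)"
proof -
  have add: "A (u + v) = A u + A v" for u v
    using assms by (simp add: linear_on_algebra_def)
  have scal: "A (scalar \<alpha> * u) = scalar \<alpha> * A u" for \<alpha> u
    using assms by (simp add: linear_on_algebra_def)
  interpret A: additive A
    by standard (rule add)
  have "A x = A (\<Sum>k\<in>UNIV. scalar (lookup x k) * Poly_Mapping.single k 1)"
    by (simp add: mult_single sum_single_lookup)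
  also have "\<dots> = (\<Sum>k\<in>UNIV. scalar (lookup x k) * A (Poly_Mapping.single k 1))"
    by (simp add: A.sum scal)
  finally show ?thesis
    by (simp add: lookup_sum lookup_single_mult)
qed

lemma trace_comp_commute:
  assumes "linear_on_algebra A" and "linear_on_algebra B"
  shows "trace (A \<circ> B) = trace (B \<circ> A)"
proof -
  let ?e = "\<lambda>g. Poly_Mapping.single g 1"
  have "trace (A \<circ> B) = (\<Sum>g\<in>UNIV. \<Sum>k\<in>UNIV. lookup (B (?e g)) k * lookup (A (?e k)) g)"
    unfolding trace_def comp_def by (subst lookup_linear_image[OF assms(1)]) simp
  also have "\<dots> = (\<Sum>k\<in>UNIV. \<Sum>g\<in>UNIV. lookup (A (?e k)) g * lookup (B (?e g)) k)"
    by (subst sum.swap) (simp add: mult.commute)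
  also have "\<dots> = trace (B \<circ> A)"
    unfolding trace_def comp_def by (subst lookup_linear_image[OF assms(2)]) simp
  finally show ?thesis .
qed

text \<open>
  Multiplication by \<open>x\<close> on either side sends each basis element \<open>g\<close> to an element
  whose coefficient at \<open>g\<close> is that of \<open>x\<close> at the identity, so every diagonal entry is the same.
\<close>

lemma trace_left_mult:
  fixes x :: "('g::{group_add, finite}, 'f::field) group_algebra"
  shows "trace ((*) x) = of_nat (card (UNIV :: 'g set)) * lookup x 0"
  by (simp add: trace_def lookup_mult_single)

lemma trace_right_mult:
  fixes x :: "('g::{group_add, finite}, 'f::field) group_algebra"
  shows "trace (\<lambda>y. y * x) = of_nat (card (UNIV :: 'g set)) * lookup x 0"
  by (simp add: trace_def lookup_single_mult)

section \<open>The form attached to an involution\<close>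

lemma linear_involution:
  fixes \<sigma> :: "('g::{group_add, finite}, 'f::field) group_algebra \<Rightarrow> ('g, 'f) group_algebra"
  assumes "ring_involution \<sigma>" and "\<forall>\<alpha>. \<sigma> (scalar \<alpha>) = scalar \<alpha>"
  shows "linear_on_algebra \<sigma>"
  using assms unfolding linear_on_algebra_def ring_involution_def by (metis scalar_commute)

text \<open>
  With \<open>L\<close> and \<open>R\<close> for left and right multiplication, \<open>L (\<sigma> x) = \<sigma> \<circ> R x \<circ> \<sigma>\<close>; since
  \<open>\<sigma> \<circ> \<sigma> = id\<close>, both sides have the trace of \<open>R x\<close>.
\<close>

lemma lookup_zero_involution:
  fixes \<sigma> :: "('g::{group_add, finite}, 'f::field_char_0) group_algebra \<Rightarrow> ('g, 'f) group_algebra"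
  assumes inv: "ring_involution \<sigma>" and scal: "\<forall>\<alpha>. \<sigma> (scalar \<alpha>) = scalar \<alpha>"
  shows "lookup (\<sigma> x) 0 = lookup x 0"
proof -
  have mult: "\<sigma> (u * v) = \<sigma> v * \<sigma> u" and invol: "\<sigma> (\<sigma> u) = u" and add: "\<sigma> (u + v) = \<sigma> u + \<sigma> v"
    for u v
    using inv by (simp_all add: ring_involution_def)
  have lin: "linear_on_algebra \<sigma>"
    using inv scal by (rule linear_involution)
  have lin': "linear_on_algebra (\<lambda>y. \<sigma> y * x)"
    using lin by (simp add: linear_on_algebra_def algebra_simps)
  have "trace ((*) (\<sigma> x)) = trace (\<sigma> \<circ> (\<lambda>y. \<sigma> y * x))"
    by (simp add: comp_def mult invol)
  also have "\<dots> = trace ((\<lambda>y. \<sigma> y * x) \<circ> \<sigma>)"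
    using lin lin' by (rule trace_comp_commute)
  also have "\<dots> = trace (\<lambda>y. y * x)"
    by (simp add: comp_def invol)
  finally show ?thesis
    by (simp add: trace_left_mult trace_right_mult)
qed

definition involution_form ::
  "(('g::{group_add, finite}, 'f::field) group_algebra \<Rightarrow> ('g, 'f) group_algebra)
    \<Rightarrow> ('g, 'f) group_algebra \<Rightarrow> ('g, 'f) group_algebra \<Rightarrow> 'f" where
  "involution_form \<sigma> x y = lookup (\<sigma> x * y) 0"

lemma involution_form_scalar:
  fixes \<sigma> :: "('g::{group_add, finite}, 'f::field) group_algebra \<Rightarrow> ('g, 'f) group_algebra"
  assumes "ring_involution \<sigma>" and "\<forall>\<alpha>. \<sigma> (scalar \<alpha>) = scalar \<alpha>"
  shows "involution_form \<sigma> (scalar \<alpha> * x) (scalar \<beta> * y) = \<alpha> * involution_form \<sigma> x y * \<beta>"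
proof -
  have "\<sigma> (scalar \<alpha> * x) = scalar \<alpha> * \<sigma> x"
    using linear_involution[OF assms] by (simp add: linear_on_algebra_def)
  moreover have "scalar \<alpha> * \<sigma> x * (scalar \<beta> * y) = scalar \<alpha> * (\<sigma> x * y * scalar \<beta>)"
    by (metis mult.assoc scalar_commute)
  ultimately show ?thesis
    by (simp add: involution_form_def lookup_single_mult lookup_mult_single)
qed

lemma involution_form_symmetric:
  fixes \<sigma> :: "('g::{group_add, finite}, 'f::field_char_0) group_algebra \<Rightarrow> ('g, 'f) group_algebra"
  assumes "ring_involution \<sigma>" and "\<forall>\<alpha>. \<sigma> (scalar \<alpha>) = scalar \<alpha>"
  shows "involution_form \<sigma> y x = involution_form \<sigma> x y"
proof -
  have "\<sigma> y * x = \<sigma> (\<sigma> x * y)"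
    using assms(1) by (simp add: ring_involution_def)
  then show ?thesis
    unfolding involution_form_def using lookup_zero_involution[OF assms] by metis
qed

lemma involution_form_nonsingular:
  fixes \<sigma> :: "('g::{group_add, finite}, 'f::field) group_algebra \<Rightarrow> ('g, 'f) group_algebra"
  assumes inv: "ring_involution \<sigma>" and zero: "\<And>y. involution_form \<sigma> x y = 0"
  shows "x = 0"
proof -
  have "\<sigma> x = 0"
  proof (rule poly_mapping_eqI)
    fix g
    show "lookup (\<sigma> x) g = lookup 0 g"
      using zero[of "Poly_Mapping.single (- g) 1"]
      by (simp add: involution_form_def lookup_mult_single)
  qed
  moreover have "\<sigma> 0 = 0"
    using inv unfolding ring_involution_def by (metis add_cancel_right_right)
  ultimately show ?thesis
    using inv unfolding ring_involution_def by metis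
qed

section \<open>Transport of the regular module\<close>

lemma ex_inj_group_algebra_nat_fun:
  "\<exists>E :: ('g::finite, 'f::zero) group_algebra \<Rightarrow> nat \<Rightarrow> 'f. inj E"
proof -
  obtain i :: "'g \<Rightarrow> nat" where i: "inj i"
    using finite_imp_inj_to_nat_seg[of "UNIV :: 'g set"] by auto
  have "inj (\<lambda>(x :: ('g, 'f) group_algebra) n. lookup x (inv_into UNIV i n))"
  proof (rule injI)
    fix x y :: "('g, 'f) group_algebra"
    assume "(\<lambda>n. lookup x (inv_into UNIV i n)) = (\<lambda>n. lookup y (inv_into UNIV i n))"
    then have "lookup x (inv_into UNIV i (i g)) = lookup y (inv_into UNIV i (i g))" for g
      by metis
    then show "x = y"
      using i by (intro poly_mapping_eqI) simp
  qed
  then show ?thesis by blast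
qed

text \<open>
  Transport of structure: an arbitrary injection \<open>E\<close> becomes an isomorphism from the
  regular module, whatever operations its target type has.
\<close>

definition transported_regular_module ::
  "(('g::{group_add, finite}, 'f::field) group_algebra \<Rightarrow> 'm) \<Rightarrow> ('f, 'm) module" where
  "transported_regular_module E =
     \<lparr>carrier = range E, monoid.mult = (\<lambda>_ _. undefined), one = undefined,
      ring.zero = E 0, add = (\<lambda>a b. E (inv_into UNIV E a + inv_into UNIV E b)),
      module.smult = (\<lambda>\<alpha> a. E (scalar \<alpha> * inv_into UNIV E a))\<rparr>"

lemma transported_regular_module_simps [simp]:
  "carrier (transported_regular_module E) = range E"
  "\<zero>\<^bsub>transported_regular_module E\<^esub> = E 0"
  "a \<oplus>\<^bsub>transported_regular_module E\<^esub> b = E (inv_into UNIV E a + inv_into UNIV E b)"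
  "\<alpha> \<odot>\<^bsub>transported_regular_module E\<^esub> a = E (scalar \<alpha> * inv_into UNIV E a)"
  by (simp_all add: transported_regular_module_def)

lemma abelian_group_transported:
  assumes "inj E"
  shows "abelian_group (transported_regular_module E)"
proof (rule abelian_groupI)
  fix a assume "a \<in> carrier (transported_regular_module E)"
  then obtain x where "a = E x" by auto
  then show "\<exists>b\<in>carrier (transported_regular_module E).
      b \<oplus>\<^bsub>transported_regular_module E\<^esub> a = \<zero>\<^bsub>transported_regular_module E\<^esub>"
    using assms by (intro bexI[of _ "E (- x)"]) auto
qed (use assms in \<open>auto simp: ac_simps\<close>)

lemma module_transported:
  assumes "inj E"
  shows "module ring_of_type_algebra (transported_regular_module E)"
  using assms
  by (intro moduleI cring_from_type_algebra abelian_group_transported)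
     (auto simp: ring_of_type_algebra_def algebra_simps single_add mult_single
        simp flip: mult.assoc)

lemma finsum_transported:
  assumes "inj E" and "finite A"
  shows "finsum (transported_regular_module E) (\<lambda>b. E (k b)) A = E (sum k A)"
proof -
  interpret abelian_group "transported_regular_module E"
    using assms(1) by (rule abelian_group_transported)
  show ?thesis
    using assms(2) by induction (use assms(1) in auto)
qed

lemma fin_dim_transported:
  fixes E :: "('g::{group_add, finite}, 'f::field) group_algebra \<Rightarrow> 'm"
  assumes "inj E"
  shows "fin_dim_vector_space (transported_regular_module E)"
proof -
  let ?M = "transported_regular_module E"
  let ?e = "\<lambda>g. Poly_Mapping.single g 1 :: ('g, 'f) group_algebra"
  let ?B = "range (E \<circ> ?e)"
  have "inj ?e"
    by (rule injI) (metis lookup_single_eq lookup_single_not_eq zero_neq_one)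
  with assms have inj: "inj (E \<circ> ?e)"
    by (rule inj_compose)
  have "\<exists>c. a = (\<Oplus>\<^bsub>?M\<^esub>b\<in>?B. c b \<odot>\<^bsub>?M\<^esub> b)" if a: "a \<in> carrier ?M" for a
  proof -
    obtain x where x: "a = E x"
      using a by auto
    define c where "c b = lookup x (inv_into UNIV (E \<circ> ?e) b)" for b
    have c: "c (E (?e g)) = lookup x g" for g
      using inv_f_f[OF inj, of g] by (simp add: c_def)
    have "(\<Oplus>\<^bsub>?M\<^esub>b\<in>?B. c b \<odot>\<^bsub>?M\<^esub> b) = E (\<Sum>b\<in>?B. scalar (c b) * inv_into UNIV E b)"
      unfolding transported_regular_module_simps
      by (rule finsum_transported) (use assms in auto)
    also have "(\<Sum>b\<in>?B. scalar (c b) * inv_into UNIV E b) = (\<Sum>g\<in>UNIV. scalar (lookup x g) * ?e g)"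
      by (subst sum.reindex[OF inj]) (simp add: assms c)
    also have "\<dots> = x"
      by (simp add: mult_single sum_single_lookup)
    finally show ?thesis
      using x by metis
  qed
  moreover have "finite ?B" and "?B \<subseteq> carrier ?M"
    by auto
  ultimately show ?thesis
    unfolding fin_dim_vector_space_def using module_transported[OF assms] by blast
qed

section \<open>Every involution over the base field is an adjoint involution\<close>

theorem theorem1p1:
  fixes \<sigma> :: "('g::{group_add, finite}, 'f::field_char_0) group_algebra \<Rightarrow> ('g, 'f) group_algebra"
  assumes "\<forall>x::'f. Polynomial.algebraic x"
    and "ring_involution \<sigma>"
    and "\<forall>\<alpha>::'f. \<sigma> (scalar \<alpha>) = scalar \<alpha>"
  shows "\<exists>(\<theta> :: 'f \<Rightarrow> 'f) (M :: ('f, nat \<Rightarrow> 'f) module)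
            (act :: ('g, 'f) group_algebra \<Rightarrow> (nat \<Rightarrow> 'f) \<Rightarrow> (nat \<Rightarrow> 'f))
            (h :: (nat \<Rightarrow> 'f) \<Rightarrow> (nat \<Rightarrow> 'f) \<Rightarrow> 'f).
           ring_involution \<theta> \<and>
           fin_dim_vector_space M \<and> left_module M act \<and> compatible_action M act \<and>
           (hermitian_form M \<theta> h \<or> skew_hermitian_form M \<theta> h) \<and>
           nonsingular_form M h \<and>
           adjoint_involution M act h \<sigma> \<and>
           skew_elements \<sigma> =
             {f. \<forall>x\<in>carrier M. \<forall>y\<in>carrier M. h (act f x) y + h x (act f y) = 0}"
proof -
  obtain E :: "('g, 'f) group_algebra \<Rightarrow> nat \<Rightarrow> 'f" where E: "inj E"
    using ex_inj_group_algebra_nat_fun by blast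
  define M where "M = transported_regular_module E"
  define act where "act f a = E (f * inv_into UNIV E a)" for f a
  define h where "h a b = involution_form \<sigma> (inv_into UNIV E a) (inv_into UNIV E b)" for a b
  note form = involution_form_def
  have mult: "\<sigma> (u * v) = \<sigma> v * \<sigma> u" and add: "\<sigma> (u + v) = \<sigma> u + \<sigma> v" and invol: "\<sigma> (\<sigma> u) = u"
    for u v
    using assms(2) by (simp_all add: ring_involution_def)
  have theta: "ring_involution (id :: 'f \<Rightarrow> 'f)"
    by (simp add: ring_involution_def)
  have left: "left_module M act"
    using E unfolding M_def act_def
    by (intro left_module.intro left_module_axioms.intro abelian_group_transported)
       (auto simp: algebra_simps)
  have compat: "compatible_action M act"
    by (simp add: compatible_action_def M_def act_def)
  have "involution_form \<sigma> (u + v) w = involution_form \<sigma> u w + involution_form \<sigma> v w"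
    and "involution_form \<sigma> u (v + w) = involution_form \<sigma> u v + involution_form \<sigma> u w"
    for u v w
    by (simp_all add: form add algebra_simps lookup_add)
  then have "sesquilinear_form M id h"
    using E by (auto simp: sesquilinear_form_def M_def h_def
      involution_form_scalar[OF assms(2,3)])
  then have herm: "hermitian_form M id h"
    using involution_form_symmetric[OF assms(2,3)]
    by (simp add: hermitian_form_def h_def)
  have nonsing: "nonsingular_form M h"
    using E involution_form_nonsingular[OF assms(2)]
    by (auto simp: nonsingular_form_def M_def h_def)
  have adj: "h x (act f y) = h (act (\<sigma> f) x) y" for f x y
    using E by (simp add: h_def act_def form mult invol mult.assoc)
  have skew_iff: "f \<in> skew_elements \<sigma> \<longleftrightarrow>
      (\<forall>x\<in>carrier M. \<forall>y\<in>carrier M. h (act f x) y + h x (act f y) = 0)" for f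
  proof -
    have sum: "h (act f (E x)) (E y) + h (E x) (act f (E y))
        = involution_form \<sigma> ((f + \<sigma> f) * x) y" for x y
      using E unfolding adj
      by (simp add: h_def act_def form add mult invol distrib_right distrib_left lookup_add)
    have "(\<forall>x\<in>carrier M. \<forall>y\<in>carrier M. h (act f x) y + h x (act f y) = 0)
        \<longleftrightarrow> (\<forall>x y. involution_form \<sigma> ((f + \<sigma> f) * x) y = 0)"
      by (simp add: M_def sum)
    also have "\<dots> \<longleftrightarrow> f + \<sigma> f = 0"
    proof
      \<comment> \<open>Faithfulness of the regular module: test on the unit.\<close>
      assume "\<forall>x y. involution_form \<sigma> ((f + \<sigma> f) * x) y = 0"
      then have "involution_form \<sigma> ((f + \<sigma> f) * 1) y = 0" for y
        by blast
      then show "f + \<sigma> f = 0"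
        using involution_form_nonsingular[OF assms(2)] by simp
    next
      have "\<sigma> 0 = 0"
        using add by (metis add_cancel_right_right)
      then show "\<forall>x y. involution_form \<sigma> ((f + \<sigma> f) * x) y = 0" if "f + \<sigma> f = 0"
        using that by (simp add: form)
    qed
    also have "\<dots> \<longleftrightarrow> f \<in> skew_elements \<sigma>"
      by (simp add: skew_elements_def eq_neg_iff_add_eq_0 add.commute)
    finally show ?thesis by simp
  qed
  have "fin_dim_vector_space M"
    unfolding M_def using E by (rule fin_dim_transported)
  moreover have "adjoint_involution M act h \<sigma>"
    unfolding adjoint_involution_def using adj by blast
  ultimately show ?thesis
    using theta left compat herm nonsing skew_iff by blast
qed

end
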